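(* Let $\mathbf{K}\subset\mathbb{R}^n\times\mathbb{R}^m$ be the basic semi-algebraic set $$\mathbf{K}=\{(x,y)\in\mathbb{R}^n\times\mathbb{R}^m : x\in\mathbf{B};\ g_j(x,y)\ge 0,\ j=1,\ldots,s\},$$ where $\mathbf{B}\subset\mathbb{R}^n$ is a box or an ellipsoid and $g_1,\ldots,g_s\in\mathbb{R}[x,y]$. Assume that $\mathbf{K}$ is compact and that $\mathbf{K}_x:=\{y\in\mathbb{R}^m:(x,y)\in\mathbf{K}\}\neq\emptyset$ for every $x\in\mathbf{B}$. Let $f\in\mathbb{R}[x,y]$, let $\overline{J_f}(x):=\max_y\{f(x,y): y\in\mathbf{K}_x\}$ for $x\in\mathbf{B}$, and let $$\mathbf{R}_f:=\{x\in\mathbf{B}: f(x,y)\le 0\ \text{for all } y\in\mathbf{K}_x\}.$$ Assume that $\mathbf{B}$ and $\mathbf{R}_f$ have nonempty interior and that the set $\{x\in\mathbf{B}:\overline{J_f}(x)=0\}$ has Lebesgue measure zero. Let $(p_k)_{k\in\mathbb{N}}\subset\mathbb{R}[x]$ be a sequence of polynomials such that $p_k(x)\ge f(x,y)$ for all $y\in\mathbf{K}_x$, $x\in\mathbf{B}$, and all $k\in\mathbb{N}$, and $$\lim_{k\to\infty}\int_{\mathbf{B}}|p_k(x)-\overline{J_f}(x)|\,dx=0.$$ For every $k\in\mathbb{N}$ let $\mathbf{R}_f^k:=\{x\in\mathbf{B}: p_k(x)\le 0\}$. Then $\mathbf{R}_f^k\subset\mathbf{R}_f$ for every $k$, and $$\mathrm{vol}\left(\mathbf{R}_f\setminus\mathbf{R}_f^k\right)\to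 0\quad\text{as } k\to\infty.$$
   Context: $\mathbb{R}[x]$ and $\mathbb{R}[x,y]$ are the rings of real polynomials in $x=(x_1,\ldots,x_n)$ and in $(x,y)=(x_1,\ldots,x_n,y_1,\ldots,y_m)$. $\mathrm{vol}(\cdot)$ denotes Lebesgue volume in $\mathbb{R}^n$, and $dx$ denotes integration with respect to Lebesgue measure. *)

theory Defs
  imports "HOL-Analysis.Analysis"
begin

text \<open>
  Real polynomials in the coordinates of a Euclidean space are represented by their polynomial
  functions, \<^const>\<open>real_polynomial_function\<close>; over an infinite field this identification is
  faithful, and polynomials are only ever evaluated below.
\<close>

definition posdef :: "real ^ 'n ^ 'n \<Rightarrow> bool" where
  "posdef Q \<longleftrightarrow> transpose Q = Q \<and> (\<forall>v. v \<noteq> 0 \<longrightarrow> 0 < v \<bullet> (Q *v v))"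

definition is_ellipsoid :: "(real ^ 'n) set \<Rightarrow> bool" where
  "is_ellipsoid E \<longleftrightarrow> (\<exists>c Q. posdef Q \<and> E = {x. (x - c) \<bullet> (Q *v (x - c)) \<le> 1})"

definition semialg_set ::
  "'a set \<Rightarrow> nat \<Rightarrow> (nat \<Rightarrow> 'a \<times> 'b \<Rightarrow> real) \<Rightarrow> ('a \<times> 'b) set" where
  "semialg_set B s g = {(x, y). x \<in> B \<and> (\<forall>j\<in>{1..s}. 0 \<le> g j (x, y))}"

definition fiber :: "('a \<times> 'b) set \<Rightarrow> 'a \<Rightarrow> 'b set" where
  "fiber K x = {y. (x, y) \<in> K}"

text \<open>
  The maximum of \<open>f(x, \<cdot>)\<close> over the fiber: its greatest value, not merely its supremum
  (\<^const>\<open>Max\<close> is restricted to finite sets). It is meaningful whenever the maximum is attained,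
  in particular if \<open>f\<close> is continuous, \<open>K\<close> is compact and the fiber is nonempty.
\<close>

definition J_upper :: "('a \<times> 'b) set \<Rightarrow> ('a \<times> 'b \<Rightarrow> real) \<Rightarrow> 'a \<Rightarrow> real" where
  "J_upper K f x = (GREATEST v. v \<in> {f (x, y) | y. y \<in> fiber K x})"

definition R_set :: "'a set \<Rightarrow> ('a \<times> 'b) set \<Rightarrow> ('a \<times> 'b \<Rightarrow> real) \<Rightarrow> 'a set" where
  "R_set B K f = {x \<in> B. \<forall>y\<in>fiber K x. f (x, y) \<le> 0}"

definition R_inner :: "'a set \<Rightarrow> ('a \<Rightarrow> real) \<Rightarrow> 'a set" where
  "R_inner B q = {x \<in> B. q x \<le> 0}"

end

theory Submission
  imports Defs
begin

text \<open>
  Since all fibers over \<open>B\<close> are nonempty, \<open>B\<close> is the projection of \<open>K\<close>, hence compact. The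
  superlevel sets of \<open>J = J_upper K f\<close> are projections of compact sets, so \<open>J\<close> is upper
  semicontinuous, thus measurable and bounded on \<open>B\<close>. A point of \<open>R_f\<close> outside \<open>R_f^k\<close> satisfies
  \<open>-\<epsilon> < J \<le> 0\<close> or \<open>\<bar>p\<^sub>k - J\<bar> \<ge> \<epsilon>\<close>. By Markov's inequality the second alternative has measure
  tending to \<open>0\<close> as \<open>k\<close> grows, and the measure of the first tends to that of \<open>{J = 0}\<close>, which is
  \<open>0\<close>, as \<open>\<epsilon>\<close> decreases.
\<close>

text \<open>The measure-theoretic core, separated from polynomials and fibers. A sign disagreement
  of \<open>J\<close> and \<open>p k\<close> forces either \<open>J\<close> to be close to 0 or the
  two functions to be far apart; finiteness of the measure gives continuity from above for the first
  case.\<close>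

lemma (in finite_measure) L1_tendsto_imp_sign_defect_tendsto_0:
  fixes J :: "'a \<Rightarrow> real" and p :: "nat \<Rightarrow> 'a \<Rightarrow> real"
  assumes J [measurable]: "J \<in> borel_measurable M"
    and p [measurable]: "\<And>k. p k \<in> borel_measurable M"
    and int: "\<And>k. integrable M (\<lambda>x. \<bar>p k x - J x\<bar>)"
    and null: "measure M {x \<in> space M. J x = 0} = 0"
    and lim: "(\<lambda>k. \<integral>x. \<bar>p k x - J x\<bar> \<partial>M) \<longlonglongrightarrow> 0"
  shows "(\<lambda>k. measure M {x \<in> space M. J x \<le> 0 \<and> 0 < p k x}) \<longlonglongrightarrow> 0"
proof (rule LIMSEQ_I)
  fix e :: real assume e: "0 < e"
  \<comment> \<open>\<open>Suc n\<close> keeps the width positive: since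
    \<open>inverse 0 = 0\<close>, index 0 would otherwise give the empty set and the bands would not
    decrease.\<close>
  define A where "A n = {x \<in> space M. - inverse (real (Suc n)) < J x \<and> J x \<le> 0}" for n
  have A_meas: "A n \<in> sets M" for n
    unfolding A_def by measurable
  have "decseq A"
  proof (rule antimonoI)
    fix m n :: nat assume "m \<le> n"
    then have "inverse (real (Suc n)) \<le> inverse (real (Suc m))"
      by (intro le_imp_inverse_le) auto
    then show "A n \<subseteq> A m" unfolding A_def by clarify linarith
  qed
  moreover have "(\<Inter>n. A n) = {x \<in> space M. J x = 0}"
  proof -
    have "J x = 0" if "\<And>n. x \<in> A n" for x
    proof (rule ccontr)
      assume "J x \<noteq> 0"
      with that[of 0] have "0 < - J x" by (auto simp: A_def)
      then obtain n where "inverse (real (Suc n)) < - J x"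
        using reals_Archimedean by blast
      with that[of n] show False by (auto simp: A_def)
    qed
    then show ?thesis by (auto simp: A_def)
  qed
  ultimately have "(\<lambda>n. measure M (A n)) \<longlonglongrightarrow> 0"
    using finite_Lim_measure_decseq[of A] A_meas null by auto
  from LIMSEQ_D[OF this, of "e / 2"] e obtain n where n: "measure M (A n) < e / 2"
    by force
  define d where "d = inverse (real (Suc n))"
  have d: "0 < d" by (simp add: d_def)
  \<comment> \<open>The factor \<open>d\<close> anticipates the division by \<open>d\<close> in
    Markov's inequality, which leaves \<open>e / 2\<close>.\<close>
  from LIMSEQ_D[OF lim, of "d * (e / 2)"] e d obtain N
    where N: "\<And>k. N \<le> k \<Longrightarrow> (\<integral>x. \<bar>p k x - J x\<bar> \<partial>M) < d * (e / 2)"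
    by force
  have "norm (measure M {x \<in> space M. J x \<le> 0 \<and> 0 < p k x} - 0) < e" if "N \<le> k" for k
  proof -
    let ?H = "{x \<in> space M. d \<le> \<bar>p k x - J x\<bar>}"
    have H: "?H \<in> sets M" by measurable
    \<comment> \<open>Outside the band \<open>A n\<close>, \<open>J x \<le> 0\<close> means
      \<open>J x \<le> -d\<close>, and then \<open>0 < p k x\<close> puts \<open>p k x\<close> more
      than \<open>d\<close> above \<open>J x\<close>.\<close>
    have "measure M {x \<in> space M. J x \<le> 0 \<and> 0 < p k x} \<le> measure M (A n \<union> ?H)"
      using A_meas H by (intro finite_measure_mono) (auto simp: A_def d_def)
    also have "\<dots> \<le> measure M (A n) + measure M ?H"
      using A_meas H by (intro measure_Un_le)
    finally have "measure M {x \<in> space M. J x \<le> 0 \<and> 0 < p k x}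
      \<le> measure M (A n) + measure M ?H" .
    moreover have "measure M ?H \<le> (\<integral>x. \<bar>p k x - J x\<bar> \<partial>M) / d"
      using integral_Markov_inequality_measure[OF int sets.empty_sets _ d, of k] by simp
    moreover have "(\<integral>x. \<bar>p k x - J x\<bar> \<partial>M) / d < e / 2"
      using N[OF that] d by (simp add: pos_divide_less_eq mult.commute)
    ultimately have "measure M {x \<in> space M. J x \<le> 0 \<and> 0 < p k x} < e"
      using n by linarith
    then show ?thesis by simp
  qed
  then show "\<exists>N. \<forall>k\<ge>N. norm (measure M {x \<in> space M. J x \<le> 0 \<and> 0 < p k x} - 0) < e"
    by blast
qed

lemma compact_fiber:
  fixes K :: "('a::metric_space \<times> 'b::metric_space) set"
  assumes "compact K"
  shows "compact (fiber K x)"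
proof -
  have "compact (snd ` (K \<inter> ({x} \<times> UNIV)))"
    using assms
    by (intro compact_continuous_image compact_Int_closed continuous_intros closed_Times) auto
  moreover have "snd ` (K \<inter> ({x} \<times> UNIV)) = fiber K x"
    by (force simp: fiber_def)
  ultimately show ?thesis by simp
qed

text \<open>\<open>GREATEST\<close> is a definite description and says nothing until a greatest
  value is exhibited. Compactness of the fiber provides one; the later facts about
  \<open>J_upper\<close> rest on this.\<close>

lemma J_upper_attained:
  fixes K :: "('a::metric_space \<times> 'b::metric_space) set"
  assumes K: "compact K" and f: "continuous_on K f" and ne: "fiber K x \<noteq> {}"
  obtains y where "y \<in> fiber K x" "J_upper K f x = f (x, y)"
    "\<And>z. z \<in> fiber K x \<Longrightarrow> f (x, z) \<le> J_upper K f x"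
proof -
  have "continuous_on (fiber K x) (\<lambda>y. f (x, y))"
    by (rule continuous_on_compose2[OF f]) (auto intro!: continuous_intros simp: fiber_def)
  from continuous_attains_sup[OF compact_fiber[OF K] ne this]
  obtain y where y: "y \<in> fiber K x" "\<And>z. z \<in> fiber K x \<Longrightarrow> f (x, z) \<le> f (x, y)"
    by blast
  then have "J_upper K f x = f (x, y)"
    unfolding J_upper_def by (intro Greatest_equality) auto
  with y show ?thesis using that by auto
qed

lemma J_upper_le_iff:
  fixes K :: "('a::metric_space \<times> 'b::metric_space) set"
  assumes "compact K" "continuous_on K f" "fiber K x \<noteq> {}"
  shows "J_upper K f x \<le> c \<longleftrightarrow> (\<forall>y\<in>fiber K x. f (x, y) \<le> c)"
proof -
  obtain y where "y \<in> fiber K x" "J_upper K f x = f (x, y)"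
    "\<And>z. z \<in> fiber K x \<Longrightarrow> f (x, z) \<le> J_upper K f x"
    using J_upper_attained[OF assms] by blast
  then show ?thesis by (auto intro: order_trans)
qed

text \<open>Because the maximum is attained, it reaches \<open>c\<close> exactly when some fiber
  point has \<open>f\<close>-value at least \<open>c\<close>, so the set is the projection of a
  compact part of \<open>K\<close>. Staying inside the projection of \<open>K\<close> avoids empty
  fibers, where \<open>J_upper\<close> is unspecified.\<close>

lemma compact_J_upper_superlevel:
  fixes K :: "('a::metric_space \<times> 'b::metric_space) set"
  assumes K: "compact K" and f: "continuous_on K f"
  shows "compact {x \<in> fst ` K. c \<le> J_upper K f x}"
proof -
  have "{x \<in> fst ` K. c \<le> J_upper K f x} = fst ` (K \<inter> f -` {c..})"
  proof (intro set_eqI iffI)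
    fix x assume x: "x \<in> {x \<in> fst ` K. c \<le> J_upper K f x}"
    then have "fiber K x \<noteq> {}" by (auto simp: fiber_def)
    then obtain y where "y \<in> fiber K x" "J_upper K f x = f (x, y)"
      by (rule J_upper_attained[OF K f])
    with x have "(x, y) \<in> K \<inter> f -` {c..}" by (simp add: fiber_def)
    then show "x \<in> fst ` (K \<inter> f -` {c..})" by (rule image_eqI[rotated]) simp
  next
    fix x assume "x \<in> fst ` (K \<inter> f -` {c..})"
    then obtain y where y: "(x, y) \<in> K" "c \<le> f (x, y)" by auto
    then have fib: "y \<in> fiber K x" by (simp add: fiber_def)
    then have "fiber K x \<noteq> {}" by blast
    from J_upper_le_iff[OF K f this, of "J_upper K f x"] fib
    have "f (x, y) \<le> J_upper K f x" by simp
    with y show "x \<in> {x \<in> fst ` K. c \<le> J_upper K f x}" by force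
  qed
  moreover have "compact (K \<inter> f -` {c..})"
  proof -
    have "closedin (top_of_set K) (K \<inter> f -` {c..})"
      by (intro continuous_closedin_preimage f) auto
    with K show ?thesis by (rule closedin_compact)
  qed
  ultimately show ?thesis
    by (auto intro!: compact_continuous_image continuous_intros)
qed

lemma borel_measurable_J_upper:
  fixes K :: "('a::euclidean_space \<times> 'b::metric_space) set"
  assumes K: "compact K" and f: "continuous_on K f"
  shows "J_upper K f \<in> borel_measurable (lebesgue_on (fst ` K))"
proof -
  have "compact (fst ` K)"
    using K by (intro compact_continuous_image continuous_intros)
  then have "fst ` K \<in> sets lebesgue"
    by (auto dest: lmeasurable_compact)
  moreover have "{x \<in> fst ` K. c \<le> J_upper K f x} \<in> sets lebesgue" for c
    using lmeasurable_compact[OF compact_J_upper_superlevel[OF K f]] by auto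
  ultimately show ?thesis
    unfolding borel_measurable_iff_ge
    by (auto simp: sets_restrict_space_iff)
qed

text \<open>Attained maxima are values of \<open>f\<close> on \<open>K\<close>. The bound later
  yields integrability.\<close>

lemma bounded_J_upper:
  fixes K :: "('a::metric_space \<times> 'b::metric_space) set"
  assumes K: "compact K" and f: "continuous_on K f"
  shows "bounded (J_upper K f ` fst ` K)"
proof (rule bounded_subset)
  show "bounded (f ` K)"
    using K f by (intro compact_imp_bounded compact_continuous_image)
  show "J_upper K f ` fst ` K \<subseteq> f ` K"
  proof clarsimp
    fix x y assume "(x, y) \<in> K"
    then have "fiber K x \<noteq> {}" by (auto simp: fiber_def)
    then obtain z where "z \<in> fiber K x" "J_upper K f x = f (x, z)"
      by (rule J_upper_attained[OF K f])
    then show "J_upper K f x \<in> f ` K" by (simp add: fiber_def)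
  qed
qed

theorem theorem3:
  fixes B :: "(real ^ 'n) set"
    and K :: "((real ^ 'n) \<times> (real ^ 'm)) set"
    and s :: nat
    and g :: "nat \<Rightarrow> (real ^ 'n) \<times> (real ^ 'm) \<Rightarrow> real"
    and f :: "(real ^ 'n) \<times> (real ^ 'm) \<Rightarrow> real"
    and p :: "nat \<Rightarrow> real ^ 'n \<Rightarrow> real"
  assumes B_shape: "(\<exists>a b. B = cbox a b) \<or> is_ellipsoid B"
    and g_poly: "\<And>j. j \<in> {1..s} \<Longrightarrow> real_polynomial_function (g j)"
    and K_eq: "K = semialg_set B s g"
    and K_compact: "compact K"
    and K_fiber: "\<And>x. x \<in> B \<Longrightarrow> fiber K x \<noteq> {}"
    and f_poly: "real_polynomial_function f"
    and B_interior: "interior B \<noteq> {}"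
    and R_interior: "interior (R_set B K f) \<noteq> {}"
    and J_null: "{x \<in> B. J_upper K f x = 0} \<in> null_sets lebesgue"
    and p_poly: "\<And>k. real_polynomial_function (p k)"
    and p_upper: "\<And>k x y. x \<in> B \<Longrightarrow> y \<in> fiber K x \<Longrightarrow> f (x, y) \<le> p k x"
    and p_lim: "(\<lambda>k. LINT x:B|lebesgue. \<bar>p k x - J_upper K f x\<bar>) \<longlonglongrightarrow> 0"
  shows "(\<forall>k. R_inner B (p k) \<subseteq> R_set B K f) \<and>
         (\<lambda>k. measure lebesgue (R_set B K f - R_inner B (p k))) \<longlonglongrightarrow> 0"
proof -
  have f_cont: "continuous_on K f"
    using f_poly by (simp add: continuous_on_polymonial_function real_polynomial_function_eq)
  have p_cont: "continuous_on B (p k)" for k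
    using p_poly by (simp add: continuous_on_polymonial_function real_polynomial_function_eq)
  \<comment> \<open>This transfers the facts proved over the projection of \<open>K\<close> to
    \<open>B\<close>.\<close>
  have B_fst: "fst ` K = B"
  proof (intro equalityI subsetI)
    fix x assume "x \<in> B"
    then obtain y where "(x, y) \<in> K"
      using K_fiber by (auto simp: fiber_def)
    then show "x \<in> fst ` K" by (rule image_eqI[rotated]) simp
  qed (auto simp: K_eq semialg_set_def)
  have B_compact: "compact B"
    unfolding B_fst[symmetric] using K_compact
    by (intro compact_continuous_image continuous_intros)
  then have B_lmeas: "B \<in> lmeasurable" and B_sets: "B \<in> sets lebesgue"
    by (auto dest: lmeasurable_compact)
  have R_eq: "R_set B K f = {x \<in> B. J_upper K f x \<le> 0}"
    unfolding R_set_def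
    by (intro Collect_cong conj_cong refl J_upper_le_iff[OF K_compact f_cont, symmetric] K_fiber)

  interpret M: finite_measure "lebesgue_on B"
    using B_lmeas by (rule finite_measure_lebesgue_on)
  have J_meas [measurable]: "J_upper K f \<in> borel_measurable (lebesgue_on B)"
    using borel_measurable_J_upper[OF K_compact f_cont] by (simp add: B_fst)
  have p_meas [measurable]: "p k \<in> borel_measurable (lebesgue_on B)" for k
    using p_cont B_sets by (rule continuous_imp_measurable_on_sets_lebesgue)
  \<comment> \<open>The integral of a non-integrable function is 0 by default, so
    \<open>p_lim\<close> does not by itself give the integrability that Markov's inequality
    requires. Boundedness on a set of finite measure does.\<close>
  have int: "integrable (lebesgue_on B) (\<lambda>x. \<bar>p k x - J_upper K f x\<bar>)" for k
  proof -
    obtain b where b: "\<And>x. x \<in> B \<Longrightarrow> norm (J_upper K f x) \<le> b"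
      using bounded_J_upper[OF K_compact f_cont] unfolding B_fst bounded_iff by auto
    obtain c where c: "\<And>x. x \<in> B \<Longrightarrow> norm (p k x) \<le> c"
      using compact_imp_bounded[OF compact_continuous_image[OF p_cont[of k] B_compact]]
      unfolding bounded_iff by auto
    have "\<bar>p k x - J_upper K f x\<bar> \<le> c + b" if "x \<in> B" for x
      using b[OF that] c[OF that] by simp
    then show ?thesis
      by (intro M.integrable_const_bound[where B = "c + b"] AE_I2) simp_all
  qed
  have null: "measure (lebesgue_on B) {x \<in> space (lebesgue_on B). J_upper K f x = 0} = 0"
  proof -
    have "measure (lebesgue_on B) {x \<in> B. J_upper K f x = 0} =
        measure lebesgue {x \<in> B. J_upper K f x = 0}"
      using B_sets by (intro measure_restrict_space) auto
    then show ?thesis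
      using measure_eq_0_null_sets[OF J_null] by simp
  qed
  have lim: "(\<lambda>k. \<integral>x. \<bar>p k x - J_upper K f x\<bar> \<partial>lebesgue_on B) \<longlonglongrightarrow> 0"
    using p_lim B_sets by (simp add: integral_restrict_space set_lebesgue_integral_def)
  have "measure (lebesgue_on B) {x \<in> space (lebesgue_on B). J_upper K f x \<le> 0 \<and> 0 < p k x} =
      measure lebesgue (R_set B K f - R_inner B (p k))" for k
  proof -
    have "R_set B K f - R_inner B (p k) = {x \<in> B. J_upper K f x \<le> 0 \<and> 0 < p k x}"
      by (auto simp: R_eq R_inner_def)
    moreover have "measure (lebesgue_on B) {x \<in> B. J_upper K f x \<le> 0 \<and> 0 < p k x} =
        measure lebesgue {x \<in> B. J_upper K f x \<le> 0 \<and> 0 < p k x}"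
      using B_sets by (intro measure_restrict_space) auto
    ultimately show ?thesis by simp
  qed
  with M.L1_tendsto_imp_sign_defect_tendsto_0[OF J_meas p_meas int null lim]
  have "(\<lambda>k. measure lebesgue (R_set B K f - R_inner B (p k))) \<longlonglongrightarrow> 0"
    by simp
  \<comment> \<open>The majorant property \<open>p_upper\<close> enters here: a nonpositive
    \<open>p k x\<close> lies above every value of \<open>f\<close> on the fiber.\<close>
  moreover have "R_inner B (p k) \<subseteq> R_set B K f" for k
    by (auto simp: R_inner_def R_set_def intro: order_trans[OF p_upper])
  ultimately show ?thesis by blast
qed

end
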